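(* Let $p$ be an odd prime and $d\in\mathbb{F}_p$, $d\ne 0,1$. If $\left(\frac{d}{p}\right)=1$, then $|E_d| = |E_{d^{-1}}|$. If $\left(\frac{d}{p}\right)=-1$, then $|E_d|+|E_{d^{-1}}| = 2p+2$.
   Context: For $c\in\mathbb{F}_p^*$, $c\ne1$, $E_c$ denotes the Edwards curve $x^2+y^2=1+cx^2y^2$ over $\mathbb{F}_p$, and $|E_c|$ denotes its order, i.e. the number of affine solutions $(x,y)\in\mathbb{F}_p^2$. $\left(\frac{d}{p}\right)$ is the Legendre symbol. *)

theory Defs
  imports "HOL-Number_Theory.Number_Theory"
begin

text \<open>Only affine points are counted; the field of \<open>p\<close> elements is \<^term>\<open>residue_ring p\<close>, whose
  elements are the integers \<open>0, \<dots>, p - 1\<close>.\<close>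

definition edwards_curve :: "('a, 'b) ring_scheme \<Rightarrow> 'a \<Rightarrow> ('a \<times> 'a) set"
  where "edwards_curve R c =
    {(x, y) \<in> carrier R \<times> carrier R.
       x [^]\<^bsub>R\<^esub> (2::nat) \<oplus>\<^bsub>R\<^esub> y [^]\<^bsub>R\<^esub> (2::nat) =
       \<one>\<^bsub>R\<^esub> \<oplus>\<^bsub>R\<^esub> c \<otimes>\<^bsub>R\<^esub> x [^]\<^bsub>R\<^esub> (2::nat) \<otimes>\<^bsub>R\<^esub> y [^]\<^bsub>R\<^esub> (2::nat)}"

definition edwards_order :: "('a, 'b) ring_scheme \<Rightarrow> 'a \<Rightarrow> nat"
  where "edwards_order R c = card (edwards_curve R c)"

end

theory Submission
  imports Defs
begin

text \<open>Fibre both curves over the \<open>x\<close>-axis. For \<open>x \<noteq> 0\<close>, the fibre of \<open>E\<^sub>d\<close> over \<open>x\<close> is given by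
  \<open>(1 - d x\<^sup>2) y\<^sup>2 = 1 - x\<^sup>2\<close> and that of \<open>E\<^bsub>1/d\<^esub>\<close> over \<open>1/x\<close> by
  \<open>(1 - d x\<^sup>2) z\<^sup>2 = d (1 - x\<^sup>2)\<close>. If \<open>d = e\<^sup>2\<close>, then \<open>z = e y\<close> is a bijection between them. If \<open>d\<close> is
  not a square, then \<open>1 - d x\<^sup>2 \<noteq> 0\<close>, and the two fibres have two elements altogether, because for
  every \<open>v\<close> the equations \<open>y\<^sup>2 = v\<close> and \<open>z\<^sup>2 = d v\<close> together have two solutions. Over
  \<open>x = 0\<close> both fibres are \<open>y\<^sup>2 = 1\<close>.\<close>

section \<open>Counting by fibres\<close>

definition edwards_fibre :: "('a, 'b) ring_scheme \<Rightarrow> 'a \<Rightarrow> 'a \<Rightarrow> 'a set"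
  where "edwards_fibre R c x = {y \<in> carrier R. (x, y) \<in> edwards_curve R c}"

lemma edwards_order_fibres:
  assumes "finite (carrier R)"
  shows "edwards_order R c = (\<Sum>x\<in>carrier R. card (edwards_fibre R c x))"
proof -
  have "edwards_curve R c = Sigma (carrier R) (edwards_fibre R c)"
    by (auto simp: edwards_curve_def edwards_fibre_def)
  moreover have "finite (edwards_fibre R c x)" for x
    using assms by (simp add: edwards_fibre_def)
  ultimately show ?thesis
    using assms by (simp add: edwards_order_def card_SigmaI)
qed

text \<open>Every element of \<open>A\<close> lies over exactly one point of \<open>B\<close>. This
  serves the double count of square roots, with maps of the field into itself.\<close>

lemma sum_card_fibres:
  assumes "finite A" "finite B" "f \<in> A \<rightarrow> B"
  shows "(\<Sum>b\<in>B. card {a \<in> A. f a = b}) = card A"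
proof -
  have "f ` A \<subseteq> B"
    using assms(3) by auto
  from sum_fun_comp[OF assms(1,2) this, of "\<lambda>_. 1 :: nat"] show ?thesis
    by simp
qed

section \<open>Fibres of Edwards curves over a field\<close>

context field
begin

text \<open>Reduces the equivalence of two equations to one ring identity between the differences of
  their sides.\<close>

lemma eq_iff_eq_of_minus_eq:
  assumes "a \<ominus> b = c \<ominus> d" "a \<in> carrier R" "b \<in> carrier R" "c \<in> carrier R" "d \<in> carrier R"
  shows "a = b \<longleftrightarrow> c = d"
  using assms by (metis r_right_minus_eq)

lemma mult_eq_iff_eq_inv_mult:
  assumes "a \<in> carrier R" "a \<noteq> \<zero>" "w \<in> carrier R" "u \<in> carrier R"
  shows "a \<otimes> w = u \<longleftrightarrow> w = inv a \<otimes> u"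
  using assms by (auto simp: field_Units simp flip: m_assoc)

lemma edwards_fibre_eq:
  assumes "c \<in> carrier R" "x \<in> carrier R"
  shows "edwards_fibre R c x =
    {y \<in> carrier R. (\<one> \<ominus> c \<otimes> x [^] (2::nat)) \<otimes> y [^] (2::nat) = \<one> \<ominus> x [^] (2::nat)}"
proof -
  have "x [^] (2::nat) \<oplus> y [^] (2::nat) = \<one> \<oplus> c \<otimes> x [^] (2::nat) \<otimes> y [^] (2::nat) \<longleftrightarrow>
      (\<one> \<ominus> c \<otimes> x [^] (2::nat)) \<otimes> y [^] (2::nat) = \<one> \<ominus> x [^] (2::nat)" (is "?l = ?r \<longleftrightarrow> ?l' = ?r'")
    if y: "y \<in> carrier R" for y
  proof -
    have "x [^] (2::nat) \<in> carrier R" "y [^] (2::nat) \<in> carrier R"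
      using assms y by simp_all
    then have "?l \<ominus> ?r = ?l' \<ominus> ?r'"
      using assms(1) by algebra
    then show ?thesis
      using assms y by (intro eq_iff_eq_of_minus_eq) simp_all
  qed
  then show ?thesis
    using assms by (auto simp: edwards_fibre_def edwards_curve_def)
qed

text \<open>Multiplying the fibre equation over \<open>inv x\<close> by the nonzero factor c x^2
  clears both inverses. Up to sign, the result has the same coefficient 1 - c x^2 as the fibre of
  the curve for \<open>c\<close> over \<open>x\<close>, so the two fibres can be compared.\<close>

lemma edwards_fibre_inv_eq:
  assumes c: "c \<in> carrier R" "c \<noteq> \<zero>" and x: "x \<in> carrier R" "x \<noteq> \<zero>"
  shows "edwards_fibre R (inv c) (inv x) =
    {z \<in> carrier R. (\<one> \<ominus> c \<otimes> x [^] (2::nat)) \<otimes> z [^] (2::nat) = c \<otimes> (\<one> \<ominus> x [^] (2::nat))}"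
proof -
  define c' x' where "c' = inv c" and "x' = inv x"
  have inv: "c' \<in> carrier R" "x' \<in> carrier R" "c \<otimes> c' = \<one>"
    "x [^] (2::nat) \<otimes> x' [^] (2::nat) = \<one>"
    using c x by (simp_all add: c'_def x'_def field_Units flip: nat_pow_distrib)
  have "(\<one> \<ominus> c' \<otimes> x' [^] (2::nat)) \<otimes> z [^] (2::nat) = \<one> \<ominus> x' [^] (2::nat) \<longleftrightarrow>
      (\<one> \<ominus> c \<otimes> x [^] (2::nat)) \<otimes> z [^] (2::nat) = c \<otimes> (\<one> \<ominus> x [^] (2::nat))"
      (is "?l = ?r \<longleftrightarrow> ?l' = ?r'")
    if z: "z \<in> carrier R" for z
  proof -
    have squares: "x [^] (2::nat) \<in> carrier R" "x' [^] (2::nat) \<in> carrier R" "z [^] (2::nat) \<in> carrier R"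
      using x(1) inv(2) z by simp_all
    \<comment> \<open>The terms are grouped so that each element stands next to its inverse; these
      products then become 1.\<close>
    then have "c \<otimes> x [^] (2::nat) \<otimes> (?l \<ominus> ?r) =
        c \<otimes> x [^] (2::nat) \<otimes> z [^] (2::nat)
        \<ominus> (c \<otimes> c') \<otimes> (x [^] (2::nat) \<otimes> x' [^] (2::nat)) \<otimes> z [^] (2::nat)
        \<ominus> c \<otimes> x [^] (2::nat) \<oplus> c \<otimes> (x [^] (2::nat) \<otimes> x' [^] (2::nat))"
      using c(1) inv(1) by algebra
    also have "\<dots> = \<ominus> (?l' \<ominus> ?r')"
      unfolding inv using c(1) squares by algebra
    finally have "c \<otimes> x [^] (2::nat) \<otimes> (?l \<ominus> ?r) = \<ominus> (?l' \<ominus> ?r')" .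
    moreover have "c \<otimes> x [^] (2::nat) \<noteq> \<zero>"
      using c x by (simp add: integral_iff numeral_2_eq_2)
    moreover have cl: "?l \<in> carrier R" "?r \<in> carrier R" "?l' \<in> carrier R" "?r' \<in> carrier R"
      "c \<otimes> x [^] (2::nat) \<in> carrier R"
      using c x inv z by simp_all
    ultimately have "?l \<ominus> ?r = \<zero> \<longleftrightarrow> ?l' \<ominus> ?r' = \<zero>"
      by (metis integral_iff minus_closed r_null add.inv_eq_1_iff)
    then show ?thesis
      using cl by simp
  qed
  then show ?thesis
    unfolding c'_def[symmetric] x'_def[symmetric] edwards_fibre_eq[OF inv(1,2)] by auto
qed

lemma edwards_fibre_zero:
  assumes "c \<in> carrier R"
  shows "edwards_fibre R c \<zero> = {y \<in> carrier R. y [^] (2::nat) = \<one>}"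
proof -
  have "\<zero> [^] (2::nat) = \<zero>" "\<one> \<ominus> \<zero> = \<one>"
    by (simp_all add: numeral_2_eq_2 minus_eq)
  then have "\<one> \<ominus> c \<otimes> \<zero> [^] (2::nat) = \<one>" "\<one> \<ominus> \<zero> [^] (2::nat) = \<one>"
    using assms by (metis r_null)+
  then show ?thesis
    unfolding edwards_fibre_eq[OF assms zero_closed] by auto
qed

lemma bij_betw_inv_nonzero: "bij_betw (\<lambda>x. inv x) (carrier R - {\<zero>}) (carrier R - {\<zero>})"
proof -
  have "(\<lambda>x. inv x) \<in> carrier R - {\<zero>} \<rightarrow> carrier R - {\<zero>}"
    using Units_inv_Units field_Units by blast
  then show ?thesis
    by (intro bij_betwI[where g = "\<lambda>x. inv x"]) (simp_all add: field_Units)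
qed

lemma edwards_order_nonzero_fibres:
  assumes "finite (carrier R)" "c \<in> carrier R"
  shows "edwards_order R c = card {y \<in> carrier R. y [^] (2::nat) = \<one>} +
    (\<Sum>x\<in>carrier R - {\<zero>}. card (edwards_fibre R c x))"
  using assms
  by (simp add: edwards_order_fibres sum.remove[of _ \<zero>] edwards_fibre_zero)

text \<open>Inversion permutes the nonzero elements. Reindexing by it pairs the fibre over
  \<open>inv x\<close> with the fibre of the other curve over \<open>x\<close>.\<close>

lemma edwards_order_inv_nonzero_fibres:
  assumes "finite (carrier R)" "c \<in> carrier R" "c \<noteq> \<zero>"
  shows "edwards_order R (inv c) = card {y \<in> carrier R. y [^] (2::nat) = \<one>} +
    (\<Sum>x\<in>carrier R - {\<zero>}. card (edwards_fibre R (inv c) (inv x)))"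
  using assms sum.reindex_bij_betw[OF bij_betw_inv_nonzero, of "\<lambda>x. card (edwards_fibre R (inv c) x)"]
  by (simp add: edwards_order_nonzero_fibres field_Units)

section \<open>Square roots in a field\<close>

lemma square_eq_imp:
  assumes "x \<in> carrier R" "y \<in> carrier R" "x [^] (2::nat) = y [^] (2::nat)"
  shows "x = y \<or> x = \<ominus> y"
proof -
  have "(x \<ominus> y) \<otimes> (x \<oplus> y) = x \<otimes> x \<ominus> y \<otimes> y"
    using assms(1,2) by algebra
  also have "\<dots> = \<zero>"
    using assms by (simp add: numeral_2_eq_2)
  finally have "x \<ominus> y = \<zero> \<or> x \<oplus> y = \<zero>"
    using assms(1,2) by (simp add: integral_iff)
  then show ?thesis
    using assms(1,2) minus_equality[of x y] by auto
qed

text \<open>One root determines the others up to sign. The sharper bound at \<open>\<zero>\<close>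
  matters because there the roots of \<open>v\<close> and of \<open>d \<otimes> v\<close> are both
  present and must total at most 2.\<close>

lemma card_square_roots_le:
  assumes "v \<in> carrier R"
  shows "card {y \<in> carrier R. y [^] (2::nat) = v} \<le> (if v = \<zero> then 1 else 2)"
proof (cases "\<exists>y\<in>carrier R. y [^] (2::nat) = v")
  case True
  then obtain y where y: "y \<in> carrier R" "y [^] (2::nat) = v"
    by blast
  have "{z \<in> carrier R. z [^] (2::nat) = v} \<subseteq> {y, \<ominus> y}"
    using y square_eq_imp[of _ y] by auto
  then have "card {z \<in> carrier R. z [^] (2::nat) = v} \<le> card {y, \<ominus> y}"
    by (intro card_mono) auto
  also have "\<dots> \<le> (if v = \<zero> then 1 else 2)"
  proof (cases "v = \<zero>")
    case True
    then have "y \<otimes> y = \<zero>"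
      using y by (simp add: numeral_2_eq_2)
    then have "y = \<zero>"
      using y(1) by (simp add: integral_iff)
    then show ?thesis
      by simp
  qed (simp add: card_insert_if)
  finally show ?thesis .
next
  case False
  then have "{y \<in> carrier R. y [^] (2::nat) = v} = {}"
    by blast
  then show ?thesis
    by (simp only: card.empty le0)
qed

text \<open>Both \<open>y \<mapsto> y\<^sup>2\<close> and \<open>z \<mapsto> z\<^sup>2 / d\<close> are maps of the field into itself, so their fibre sizes
  sum to twice the size of the field. Since \<open>d\<close> is not a square, the fibres over each point have
  at most, hence exactly, two elements together.\<close>

lemma card_square_roots_nonsquare:
  assumes fin: "finite (carrier R)" and d: "d \<in> carrier R"
    and nonsquare: "\<And>e. e \<in> carrier R \<Longrightarrow> e [^] (2::nat) \<noteq> d"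
    and v: "v \<in> carrier R"
  shows "card {y \<in> carrier R. y [^] (2::nat) = v} +
    card {z \<in> carrier R. z [^] (2::nat) = d \<otimes> v} = 2"
proof -
  let ?A = "\<lambda>v. {y \<in> carrier R. y [^] (2::nat) = v}"
  let ?B = "\<lambda>v. {z \<in> carrier R. z [^] (2::nat) = d \<otimes> v}"
  have d0: "d \<noteq> \<zero>"
    using nonsquare[of \<zero>] by (auto simp: numeral_2_eq_2)
  have le: "card (?A v) + card (?B v) \<le> 2" if v: "v \<in> carrier R" for v
  proof (cases "v = \<zero>")
    case True
    then show ?thesis
      using card_square_roots_le[of \<zero>] d by simp
  next
    case False
    \<comment> \<open>If y^2 = v and z^2 = d v with v nonzero, then z/y would be a square root of
      \<open>d\<close>.\<close>
    have "?A v = {} \<or> ?B v = {}"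
    proof (rule ccontr)
      assume "\<not> ?thesis"
      then obtain y z where y: "y \<in> carrier R" "y [^] (2::nat) = v"
        and z: "z \<in> carrier R" "z [^] (2::nat) = d \<otimes> v"
        by blast
      have "y \<noteq> \<zero>"
        using False y by (auto simp: numeral_2_eq_2)
      then have inv: "inv y \<in> carrier R" "y \<otimes> inv y = \<one>"
        using y by (simp_all add: field_Units)
      have "(z \<otimes> inv y) [^] (2::nat) = z [^] (2::nat) \<otimes> inv y [^] (2::nat)"
        using z inv by (simp add: nat_pow_distrib)
      also have "\<dots> = d \<otimes> (y \<otimes> inv y) [^] (2::nat)"
        using y(1) inv(1) d by (simp add: z(2) nat_pow_distrib m_assoc flip: y(2))
      also have "\<dots> = d"
        using inv d by simp
      finally show False
        using nonsquare z(1) inv(1) m_closed by blast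
    qed
    then have "card (?A v) = 0 \<or> card (?B v) = 0"
      by (elim disjE) (simp_all only: card.empty simp_thms)
    moreover have "card (?A v) \<le> 2" "card (?B v) \<le> 2"
      using card_square_roots_le[OF v] card_square_roots_le[of "d \<otimes> v"] v d
      by (simp_all split: if_splits)
    ultimately show ?thesis
      by linarith
  qed
  have A: "(\<Sum>v\<in>carrier R. card (?A v)) = card (carrier R)"
    by (intro sum_card_fibres fin) simp
  have "inv d \<otimes> z [^] (2::nat) = v \<longleftrightarrow> z [^] (2::nat) = d \<otimes> v"
    if "z \<in> carrier R" "v \<in> carrier R" for z v
    using that d d0 mult_eq_iff_eq_inv_mult[of d v "z [^] (2::nat)"] by auto
  then have "(\<Sum>v\<in>carrier R. card (?B v)) =
      (\<Sum>v\<in>carrier R. card {z \<in> carrier R. inv d \<otimes> z [^] (2::nat) = v})"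
    by (intro sum.cong arg_cong[of _ _ card]) auto
  also have "\<dots> = card (carrier R)"
    using d d0 by (intro sum_card_fibres fin) (simp add: field_Units)
  finally have B: "(\<Sum>v\<in>carrier R. card (?B v)) = card (carrier R)" .
  have "(\<Sum>v\<in>carrier R. card (?A v) + card (?B v)) = (\<Sum>v\<in>carrier R. 2)"
    by (simp add: sum.distrib A B)
  from sum_mono_inv[OF this le v fin] show ?thesis .
qed

section \<open>Orders for d and 1/d over a finite field\<close>

theorem edwards_order_inv_square:
  assumes fin: "finite (carrier R)" and e: "e \<in> carrier R" "e \<noteq> \<zero>"
  shows "edwards_order R (e [^] (2::nat)) = edwards_order R (inv (e [^] (2::nat)))"
proof -
  define d where "d = e [^] (2::nat)"
  have d: "d \<in> carrier R" "d \<noteq> \<zero>"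
    using e by (auto simp: d_def numeral_2_eq_2 integral_iff)
  have "card (edwards_fibre R d x) = card (edwards_fibre R (inv d) (inv x))"
    if x: "x \<in> carrier R" "x \<noteq> \<zero>" for x
  proof -
    define a b where "a = \<one> \<ominus> d \<otimes> x [^] (2::nat)" and "b = \<one> \<ominus> x [^] (2::nat)"
    have cl: "a \<in> carrier R" "b \<in> carrier R"
      using d x by (simp_all add: a_def b_def)
    have inv: "inv e \<in> carrier R" "e \<otimes> inv e = \<one>"
      using e by (simp_all add: field_Units)
    \<comment> \<open>Replacing \<open>y\<close> by \<open>e \<otimes> y\<close> multiplies the left
      side by d = e^2, and the nonzero \<open>d\<close> cancels. Nothing is divided by
      \<open>a\<close>, which vanishes at x = 1/e and x = -1/e.\<close>
    have scale: "a \<otimes> (e \<otimes> y) [^] (2::nat) = d \<otimes> b \<longleftrightarrow> a \<otimes> y [^] (2::nat) = b"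
      if y: "y \<in> carrier R" for y
    proof -
      have "a \<otimes> (e \<otimes> y) [^] (2::nat) = d \<otimes> (a \<otimes> y [^] (2::nat))"
        unfolding d_def using cl e(1) y by (simp add: nat_pow_distrib m_lcomm)
      then show ?thesis
        using cl d y by (simp add: m_lcancel)
    qed
    have cancel: "e \<otimes> (inv e \<otimes> z) = z" "inv e \<otimes> (e \<otimes> z) = z" if "z \<in> carrier R" for z
      using that e inv by (simp_all add: m_comm[of "inv e" e] flip: m_assoc)
    have "a \<otimes> (inv e \<otimes> z) [^] (2::nat) = b \<longleftrightarrow> a \<otimes> z [^] (2::nat) = d \<otimes> b"
      if "z \<in> carrier R" for z
      using that scale[of "inv e \<otimes> z"] cancel inv by simp
    then have "bij_betw (\<lambda>y. e \<otimes> y) {y \<in> carrier R. a \<otimes> y [^] (2::nat) = b}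
        {z \<in> carrier R. a \<otimes> z [^] (2::nat) = d \<otimes> b}"
      using scale cancel e(1) inv(1)
      by (intro bij_betwI[where g = "\<lambda>z. inv e \<otimes> z"]) auto
    then show ?thesis
      unfolding edwards_fibre_eq[OF d(1) x(1)] edwards_fibre_inv_eq[OF d x] a_def b_def
      by (rule bij_betw_same_card)
  qed
  then have "edwards_order R d = edwards_order R (inv d)"
    using fin d
    by (simp add: edwards_order_nonzero_fibres[of d] edwards_order_inv_nonzero_fibres)
  then show ?thesis
    by (simp add: d_def)
qed

theorem edwards_order_inv_nonsquare:
  assumes fin: "finite (carrier R)" and d: "d \<in> carrier R"
    and nonsquare: "\<And>e. e \<in> carrier R \<Longrightarrow> e [^] (2::nat) \<noteq> d"
  shows "edwards_order R d + edwards_order R (inv d) = 2 * card (carrier R) + 2"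
proof -
  have d0: "d \<noteq> \<zero>"
    using nonsquare[of \<zero>] by (auto simp: numeral_2_eq_2)
  have fibres: "card (edwards_fibre R d x) + card (edwards_fibre R (inv d) (inv x)) = 2"
    if x: "x \<in> carrier R" "x \<noteq> \<zero>" for x
  proof -
    define a b where "a = \<one> \<ominus> d \<otimes> x [^] (2::nat)" and "b = \<one> \<ominus> x [^] (2::nat)"
    have cl: "a \<in> carrier R" "b \<in> carrier R"
      using d x by (simp_all add: a_def b_def)
    define x' where "x' = inv x"
    have inv: "x' \<in> carrier R" "x \<otimes> x' = \<one>"
      using x by (simp_all add: x'_def field_Units)
    \<comment> \<open>Otherwise d = (1/x)^2 would be a square.\<close>
    have "a \<noteq> \<zero>"
    proof
      assume "a = \<zero>"
      then have "\<one> = d \<otimes> x [^] (2::nat)"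
        using d x by (simp add: a_def)
      then have "x' [^] (2::nat) = d \<otimes> x [^] (2::nat) \<otimes> x' [^] (2::nat)"
        using inv by (metis l_one nat_pow_closed)
      also have "\<dots> = d \<otimes> (x \<otimes> x') [^] (2::nat)"
        using d x(1) inv(1) by (simp add: nat_pow_distrib m_assoc)
      also have "\<dots> = d"
        using d inv by simp
      finally show False
        using nonsquare inv by blast
    qed
    then have a: "a \<noteq> \<zero>" "inv a \<in> carrier R"
      using cl by (simp_all add: field_Units)
    note solve = mult_eq_iff_eq_inv_mult[OF cl(1) a(1)]
    have lcomm: "d \<otimes> (inv a \<otimes> b) = inv a \<otimes> (d \<otimes> b)"
      using cl(2) d a(2) by (intro m_lcomm)
    \<comment> \<open>Dividing by \<open>a\<close> turns the fibres into the square roots of v and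
      of d v, with v = b/a.\<close>
    have "{y \<in> carrier R. a \<otimes> y [^] (2::nat) = b} =
        {y \<in> carrier R. y [^] (2::nat) = inv a \<otimes> b}"
      using cl by (intro Collect_cong conj_cong refl solve) simp_all
    moreover have "{z \<in> carrier R. a \<otimes> z [^] (2::nat) = d \<otimes> b} =
        {z \<in> carrier R. z [^] (2::nat) = d \<otimes> (inv a \<otimes> b)}"
      unfolding lcomm using cl d by (intro Collect_cong conj_cong refl solve) simp_all
    ultimately show ?thesis
      using card_square_roots_nonsquare[OF fin d nonsquare, of "inv a \<otimes> b"] cl a
      unfolding edwards_fibre_eq[OF d x(1)] edwards_fibre_inv_eq[OF d d0 x] a_def b_def
      by simp
  qed
  \<comment> \<open>The root count at v = 1: \<open>d\<close> has no root, so both roots belong to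
    1. Hence each curve has two points over \<open>\<zero>\<close>, which gives the 4 below.\<close>
  have "{z \<in> carrier R. z [^] (2::nat) = d \<otimes> \<one>} = {}"
    using nonsquare d by auto
  then have one: "card {y \<in> carrier R. y [^] (2::nat) = \<one>} = 2"
    using card_square_roots_nonsquare[OF fin d nonsquare one_closed]
    by (simp only: card.empty add_0_right)
  \<comment> \<open>Positivity keeps the natural subtraction of 1, for the removed point
    \<open>\<zero>\<close>, from truncating.\<close>
  have "card (carrier R) > 0"
    unfolding card_gt_0_iff using fin zero_closed by blast
  then have card: "4 + 2 * (card (carrier R) - 1) = 2 * card (carrier R) + 2"
    by arith
  have "edwards_order R d + edwards_order R (inv d) = 4 +
      (\<Sum>x\<in>carrier R - {\<zero>}. card (edwards_fibre R d x) + card (edwards_fibre R (inv d) (inv x)))"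
    using fin d d0 one
    by (simp add: edwards_order_nonzero_fibres[of d] edwards_order_inv_nonzero_fibres sum.distrib)
  also have "\<dots> = 4 + 2 * (card (carrier R) - 1)"
    using fin by (simp add: fibres)
  also note card
  finally show ?thesis .
qed

end

section \<open>The prime field and the Legendre symbol\<close>

text \<open>The witness of \<open>QuadRes\<close> is an arbitrary integer; its remainder modulo
  \<open>p\<close> is a field element with the same square modulo \<open>p\<close>, and
  \<open>d\<close> is its own remainder.\<close>

lemma (in residues_prime) QuadRes_iff_square:
  assumes "d \<in> carrier R"
  shows "QuadRes (int p) d \<longleftrightarrow> (\<exists>e\<in>carrier R. e [^] (2::nat) = d)"
proof -
  have d: "d mod int p = d"
    using assms by (auto simp: res_carrier_eq)
  have square: "(y mod int p) [^] (2::nat) = d \<longleftrightarrow> [y\<^sup>2 = d] (mod int p)" for y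
    using d by (simp add: pow_cong cong_def)
  have "e mod int p = e" if "e \<in> carrier R" for e
    using that by (auto simp: res_carrier_eq)
  then show ?thesis
    unfolding QuadRes_def using square by (metis mod_in_carrier)
qed

theorem theorem5:
  fixes p :: nat and d :: int
  defines "F \<equiv> residue_ring (int p)"
  assumes "prime p" and "odd p"
    and "d \<in> carrier F" and "d \<noteq> \<zero>\<^bsub>F\<^esub>" and "d \<noteq> \<one>\<^bsub>F\<^esub>"
  shows "(Legendre d (int p) = 1 \<longrightarrow> edwards_order F d = edwards_order F (inv\<^bsub>F\<^esub> d)) \<and>
    (Legendre d (int p) = -1 \<longrightarrow> edwards_order F d + edwards_order F (inv\<^bsub>F\<^esub> d) = 2 * p + 2)"
proof -
  interpret residues_prime p F
    using \<open>prime p\<close> by unfold_locales (simp_all add: F_def)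
  have card: "card (carrier F) = p"
    by (simp add: res_carrier_eq)
  show ?thesis
  proof (intro conjI impI)
    assume "Legendre d (int p) = 1"
    then have "QuadRes (int p) d"
      by (auto simp: Legendre_def split: if_splits)
    then obtain e where e: "e \<in> carrier F" "e [^]\<^bsub>F\<^esub> (2::nat) = d"
      using QuadRes_iff_square \<open>d \<in> carrier F\<close> by blast
    then have "e \<noteq> \<zero>\<^bsub>F\<^esub>"
      using \<open>d \<noteq> \<zero>\<^bsub>F\<^esub>\<close> by (auto simp: numeral_2_eq_2)
    then show "edwards_order F d = edwards_order F (inv\<^bsub>F\<^esub> d)"
      using edwards_order_inv_square[of e] e by simp
  next
    assume "Legendre d (int p) = -1"
    then have "\<not> QuadRes (int p) d"
      by (auto simp: Legendre_def split: if_splits)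
    then show "edwards_order F d + edwards_order F (inv\<^bsub>F\<^esub> d) = 2 * p + 2"
      using edwards_order_inv_nonsquare[of d] QuadRes_iff_square \<open>d \<in> carrier F\<close> card by auto
  qed
qed

end
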